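(* Let $\alpha\vDash n$. Then \[\mathcal{R}\mathfrak{S}^*_\alpha=\sum_{S}F_{\mathrm{comp}(\mathrm{Des}_{\mathcal R\mathfrak S^*}(S))},\] where the sum is over all standard row-strict immaculate tableaux $S$ of shape $\alpha$.
   Context: For a composition $\alpha=(\alpha_1,\dots,\alpha_k)$ of $n$, its diagram has $\alpha_i$ left-justified boxes in row $i$, row 1 at the bottom. A row-strict immaculate tableau of shape $\alpha$ is a filling of the diagram with positive integers such that the entries of the leftmost column weakly increase from bottom to top and entries in each row strictly increase from left to right. Its content monomial is $x^U=\prod_i x_i^{(\#\text{ of } i\text{'s in }U)}$. The row-strict dual immaculate function is $\mathcal R\mathfrak S^*_\alpha=\sum_U x^U$ over all row-strict immaculate tableaux $U$ of shape $\alpha$. A row-strict immaculate tableau is standard if it uses each of $1,\dots,n$ exactly once. For a standard such $S$, $\mathrm{Des}_{\mathcal R\mathfrak S^*}(S)=\{i: i+1\text{ is weakly below } i\text{ in } S\}\subseteq\{1,\dots,n-1\}$. For $D\subseteq\{1,\dots,n-1\}$ with $D=\{s_1<\dots<s_j\}$, $\mathrm{comp}(D)=(s_1,s_2-s_1,\dots,n-s_j)$. The fundamental quasisymmetric function of $\beta\vDash n$ is $F_\beta=\sum x_{i_1}\cdots x_{i_n}$ over $i_1\le\cdots\le i_n$ with $i_j=i_{j+1}\Rightarrow j\notin\mathrm{set}(\beta)$, where $\mathrm{set}(\beta)=\{\beta_1,\beta_1+\beta_2,\dots,\beta_1+\dots+\beta_{\ell(\beta)-1}\}$. *)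

theory Defs
  imports "HOL-Library.Multiset" "HOL-Library.FuncSet" "HOL-Library.Function_Algebras"
begin

text \<open>
  A formal power series over the integers in the variables \<open>x\<^sub>1, x\<^sub>2, \<dots>\<close> is given by its
  coefficients.  A monomial is the multiset of the indices of its variables: the multiplicity
  of \<open>i\<close> is the exponent of \<open>x\<^sub>i\<close>.  Addition and finite sums are the pointwise ones of
  \<^theory>\<open>HOL-Library.Function_Algebras\<close> (whose pointwise product is not the product of power
  series; no products occur here).
\<close>

type_synonym power_series = "nat multiset \<Rightarrow> int"

text \<open>
  The formal, possibly infinite sum of the monomials \<open>wt a\<close>, \<open>a \<in> A\<close>: the coefficient of \<open>m\<close>
  is the number of \<open>a\<close> with \<open>wt a = m\<close>.  As \<^const>\<open>card\<close> is 0 on infinite sets, this is meaningful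
  only if each of these sets is finite; the lemmas \<open>finite_content_fibre\<close> and
  \<open>finite_fundamental_fibre\<close> below show this for both uses.
\<close>

definition monomial_sum :: "'a set \<Rightarrow> ('a \<Rightarrow> nat multiset) \<Rightarrow> power_series" where
  "monomial_sum A wt = (\<lambda>m. int (card {a \<in> A. wt a = m}))"

definition composition :: "nat list \<Rightarrow> nat \<Rightarrow> bool" where
  "composition \<alpha> n \<longleftrightarrow> (\<forall>a \<in> set \<alpha>. 0 < a) \<and> sum_list \<alpha> = n"

text \<open>
  Cells are pairs (row, column), both counted from 0.  Row 0 is the bottom row, so larger row
  numbers are higher up.
\<close>

definition diagram :: "nat list \<Rightarrow> (nat \<times> nat) set" where
  "diagram \<alpha> = {(r, c). r < length \<alpha> \<and> c < \<alpha> ! r}"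

text \<open>Fillings are \<^const>\<open>extensional\<close>, so that a tableau is determined by its entries in the diagram.\<close>

definition row_strict_tableaux :: "nat list \<Rightarrow> (nat \<times> nat \<Rightarrow> nat) set" where
  "row_strict_tableaux \<alpha> = {U \<in> diagram \<alpha> \<rightarrow>\<^sub>E {1..}.
     (\<forall>r r'. r < r' \<and> (r, 0) \<in> diagram \<alpha> \<and> (r', 0) \<in> diagram \<alpha> \<longrightarrow> U (r, 0) \<le> U (r', 0)) \<and>
     (\<forall>r c c'. c < c' \<and> (r, c) \<in> diagram \<alpha> \<and> (r, c') \<in> diagram \<alpha> \<longrightarrow> U (r, c) < U (r, c'))}"

definition content :: "nat list \<Rightarrow> (nat \<times> nat \<Rightarrow> nat) \<Rightarrow> nat multiset" where
  "content \<alpha> U = image_mset U (mset_set (diagram \<alpha>))"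

definition row_strict_dual_immaculate :: "nat list \<Rightarrow> power_series" where
  "row_strict_dual_immaculate \<alpha> = monomial_sum (row_strict_tableaux \<alpha>) (content \<alpha>)"

definition standard_row_strict_tableaux :: "nat list \<Rightarrow> (nat \<times> nat \<Rightarrow> nat) set" where
  "standard_row_strict_tableaux \<alpha> =
     {S \<in> row_strict_tableaux \<alpha>. bij_betw S (diagram \<alpha>) {1..sum_list \<alpha>}}"

definition descents :: "nat list \<Rightarrow> (nat \<times> nat \<Rightarrow> nat) \<Rightarrow> nat set" where
  "descents \<alpha> S = {i \<in> {1..<sum_list \<alpha>}. \<exists>r c r' c'.
     (r, c) \<in> diagram \<alpha> \<and> S (r, c) = i \<and> (r', c') \<in> diagram \<alpha> \<and> S (r', c') = i + 1 \<and> r' \<le> r}"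

text \<open>
  For \<open>D = {s\<^sub>1 < \<dots> < s\<^sub>j}\<close> this is \<open>(s\<^sub>1, s\<^sub>2 - s\<^sub>1, \<dots>, n - s\<^sub>j)\<close>, and \<open>(n)\<close> if \<open>D\<close> is empty.  The
  only composition of 0 is the empty one.
\<close>

definition comp_of_set :: "nat \<Rightarrow> nat set \<Rightarrow> nat list" where
  "comp_of_set n D = (if n = 0 then [] else
     (let s = sorted_list_of_set D in map2 (-) (s @ [n]) (0 # s)))"

definition set_of_comp :: "nat list \<Rightarrow> nat set" where
  "set_of_comp \<beta> = {sum_list (take k \<beta>) | k. 1 \<le> k \<and> k < length \<beta>}"

text \<open>The list \<open>w\<close> is \<open>(i\<^sub>1, \<dots>, i\<^sub>n)\<close>; since lists are indexed from 0, \<open>i\<^sub>j\<close> is \<open>w ! (j - 1)\<close>.\<close>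

definition fundamental_words :: "nat list \<Rightarrow> nat list set" where
  "fundamental_words \<beta> = {w. length w = sum_list \<beta> \<and> set w \<subseteq> {1..} \<and> sorted w \<and>
     (\<forall>j. 1 \<le> j \<and> j < sum_list \<beta> \<and> w ! (j - 1) = w ! j \<longrightarrow> j \<notin> set_of_comp \<beta>)}"

definition fundamental :: "nat list \<Rightarrow> power_series" where
  "fundamental \<beta> = monomial_sum (fundamental_words \<beta>) mset"

lemma finite_diagram: "finite (diagram \<alpha>)"
proof -
  have "diagram \<alpha> = (SIGMA r:{..<length \<alpha>}. {..<\<alpha> ! r})"
    by (auto simp: diagram_def)
  then show ?thesis by simp
qed

lemma finite_content_fibre: "finite {U \<in> row_strict_tableaux \<alpha>. content \<alpha> U = m}"
proof (rule finite_subset)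
  show "{U \<in> row_strict_tableaux \<alpha>. content \<alpha> U = m} \<subseteq> diagram \<alpha> \<rightarrow>\<^sub>E set_mset m"
    by (auto simp: row_strict_tableaux_def content_def finite_diagram PiE_iff extensional_def)
  show "finite (diagram \<alpha> \<rightarrow>\<^sub>E set_mset m)"
    by (simp add: finite_PiE finite_diagram)
qed

lemma finite_fundamental_fibre: "finite {w \<in> fundamental_words \<beta>. mset w = m}"
proof (rule finite_subset)
  show "{w \<in> fundamental_words \<beta>. mset w = m} \<subseteq>
      {w. set w \<subseteq> set_mset m \<and> length w = sum_list \<beta>}"
    by (auto simp: fundamental_words_def)
  show "finite {w. set w \<subseteq> set_mset m \<and> length w = sum_list \<beta>}"
    by (simp add: finite_lists_length_eq)
qed

lemma finite_standard_row_strict_tableaux: "finite (standard_row_strict_tableaux \<alpha>)"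
proof (rule finite_subset)
  show "standard_row_strict_tableaux \<alpha> \<subseteq> diagram \<alpha> \<rightarrow>\<^sub>E {1..sum_list \<alpha>}"
    by (auto simp: standard_row_strict_tableaux_def row_strict_tableaux_def PiE_iff extensional_def bij_betw_def)
  show "finite (diagram \<alpha> \<rightarrow>\<^sub>E {1..sum_list \<alpha>})"
    by (simp add: finite_PiE finite_diagram)
qed

end

(* Standardise a tableau by numbering its cells in increasing order of their entries, equal entries
   (which lie in different rows) from bottom to top.  Together with the word of its entries listed
   in that order, the standardisation determines the tableau.  The words that occur for a given
   standard tableau S are the weakly increasing words with a strict ascent at each descent of S,
   which are the monomials of the fundamental quasisymmetric function of S. *)

theory Submission
  imports Defs "HOL-Library.Product_Lexorder"
begin

section \<open>Subsets and compositions, and the words attached to a descent set\<close>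

lemma sum_list_take_differences:
  fixes s :: "nat list"
  assumes "sorted (s @ [n])" "k \<le> Suc (length s)"
  shows "sum_list (take k (map2 (-) (s @ [n]) (0 # s))) = (0 # s @ [n]) ! k"
  using assms(2)
proof (induction k)
  case 0
  then show ?case by simp
next
  case (Suc k)
  \<comment> \<open>Subtraction on \<open>nat\<close> is truncated, so the sum telescopes only
    because sortedness makes every difference genuine.\<close>
  have "(0 # s) ! k \<le> (s @ [n]) ! k"
  proof (cases k)
    case (Suc l)
    then show ?thesis
      using Suc.prems sorted_nth_mono[OF assms(1), of l k] by (simp add: nth_append)
  qed simp
  moreover have "(0 # s @ [n]) ! k = (0 # s) ! k"
    using Suc.prems by (cases k) (auto simp: nth_append)
  ultimately show ?case
    using Suc by (simp add: take_Suc_conv_app_nth)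
qed

text \<open>By telescoping, the first \<open>k\<close> parts sum to element \<open>k\<close> of
  \<open>0 # s @ [n]\<close>, where \<open>s\<close> lists \<open>D\<close> in increasing order.
  Proper nonempty prefixes thus give the elements of \<open>D\<close>, and the whole list gives
  \<open>n\<close>.\<close>

lemma
  assumes "D \<subseteq> {1..<n}"
  shows sum_list_comp_of_set: "sum_list (comp_of_set n D) = n"
    and set_of_comp_comp_of_set: "set_of_comp (comp_of_set n D) = D"
proof -
  define s where "s = sorted_list_of_set D"
  have D: "set s = D"
    using assms finite_subset by (fastforce simp: s_def)
  have srt: "sorted (s @ [n])"
    using assms D by (auto simp: sorted_append s_def)
  note prefix = sum_list_take_differences[OF srt]
  \<comment> \<open>For \<open>n = 0\<close> the difference formula would give \<open>[0]\<close>
    instead of the empty composition, hence the separate cases.\<close>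
  have comp: "comp_of_set n D = map2 (-) (s @ [n]) (0 # s)" if "n \<noteq> 0"
    using that by (simp add: comp_of_set_def s_def Let_def)
  show "sum_list (comp_of_set n D) = n"
  proof (cases "n = 0")
    case False
    then show ?thesis using prefix[of "Suc (length s)"] by (simp add: comp nth_append)
  qed (simp add: comp_of_set_def)
  show "set_of_comp (comp_of_set n D) = D"
  proof (cases "n = 0")
    case True
    then show ?thesis using assms by (simp add: comp_of_set_def set_of_comp_def)
  next
    case False
    have "set_of_comp (comp_of_set n D) =
        {sum_list (take k (map2 (-) (s @ [n]) (0 # s))) | k. 1 \<le> k \<and> k < Suc (length s)}"
      by (simp add: set_of_comp_def comp[OF False])
    also have "\<dots> = {(0 # s @ [n]) ! k | k. 1 \<le> k \<and> k < Suc (length s)}"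
      by (intro Collect_cong ex_cong1 iffI) (auto simp: prefix)
    also have "\<dots> = {s ! k | k. k < length s}"
    proof (intro set_eqI iffI)
      fix x assume "x \<in> {(0 # s @ [n]) ! k | k. 1 \<le> k \<and> k < Suc (length s)}"
      then obtain k where "1 \<le> k" "k < Suc (length s)" "x = (0 # s @ [n]) ! k" by blast
      then show "x \<in> {s ! k | k. k < length s}"
        by (cases k) (auto simp: nth_append)
    next
      fix x assume "x \<in> {s ! k | k. k < length s}"
      then obtain k where "k < length s" "x = s ! k" by blast
      then show "x \<in> {(0 # s @ [n]) ! k | k. 1 \<le> k \<and> k < Suc (length s)}"
        by (auto simp: nth_append intro!: exI[of _ "Suc k"])
    qed
    also have "\<dots> = D"
      using D by (simp add: set_conv_nth)
    finally show ?thesis .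
  qed
qed

lemma fundamental_words_comp_of_set:
  assumes "D \<subseteq> {1..<n}"
  shows "w \<in> fundamental_words (comp_of_set n D) \<longleftrightarrow>
    length w = n \<and> set w \<subseteq> {1..} \<and> sorted w \<and> (\<forall>j\<in>D. w ! (j - 1) \<noteq> w ! j)"
  using assms
  by (auto simp: fundamental_words_def sum_list_comp_of_set set_of_comp_comp_of_set)

lemma descents_subset: "descents \<alpha> S \<subseteq> {1..<sum_list \<alpha>}"
  by (auto simp: descents_def)

lemma card_diagram: "card (diagram \<alpha>) = sum_list \<alpha>"
proof -
  have "diagram \<alpha> = (SIGMA r:{..<length \<alpha>}. {..<\<alpha> ! r})"
    by (auto simp: diagram_def)
  then show ?thesis by (simp add: sum_list_sum_nth atLeast0LessThan)
qed

section \<open>Ranks in a finite set and the reading order of a tableau\<close>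

definition rank :: "'a set \<Rightarrow> ('a \<Rightarrow> 'b::linorder) \<Rightarrow> 'a \<Rightarrow> nat" where
  "rank A f x = card {y \<in> A. f y \<le> f x}"

lemma rank_less_iff:
  assumes "finite A" "x \<in> A" "y \<in> A"
  shows "rank A f x < rank A f y \<longleftrightarrow> f x < f y"
proof
  assume "f x < f y"
  \<comment> \<open>The inclusion is strict because \<open>y\<close> lies only in the larger
    set.\<close>
  then have "{z \<in> A. f z \<le> f x} \<subset> {z \<in> A. f z \<le> f y}"
    using assms by force
  then show "rank A f x < rank A f y"
    using assms(1) by (simp add: rank_def psubset_card_mono)
next
  assume *: "rank A f x < rank A f y"
  show "f x < f y"
  proof (rule ccontr)
    assume "\<not> f x < f y"
    then have "{z \<in> A. f z \<le> f y} \<subseteq> {z \<in> A. f z \<le> f x}" by auto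
    then have "rank A f y \<le> rank A f x"
      using assms(1) by (simp add: rank_def card_mono)
    with * show False by simp
  qed
qed

text \<open>Each element counts itself, so ranks lie between 1 and \<open>card A\<close>.
  Injectivity of \<open>f\<close> makes them distinct, and \<open>card A\<close> distinct values
  fill this interval.\<close>

lemma bij_betw_rank:
  assumes "finite A" "inj_on f A"
  shows "bij_betw (rank A f) A {1..card A}"
proof -
  have inj: "inj_on (rank A f) A"
  proof (rule inj_onI)
    fix x y assume "x \<in> A" "y \<in> A" "rank A f x = rank A f y"
    then have "f x = f y"
      using rank_less_iff[OF assms(1), of x y f] rank_less_iff[OF assms(1), of y x f] by force
    then show "x = y" using assms(2) \<open>x \<in> A\<close> \<open>y \<in> A\<close> by (simp add: inj_on_eq_iff)
  qed
  have "rank A f ` A \<subseteq> {1..card A}"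
  proof
    fix k assume "k \<in> rank A f ` A"
    then obtain x where x: "x \<in> A" "k = rank A f x" by blast
    have "x \<in> {y \<in> A. f y \<le> f x}" using x by simp
    then have "0 < rank A f x"
      using assms(1) unfolding rank_def by (auto simp: card_gt_0_iff)
    then show "k \<in> {1..card A}"
      using assms(1) x by (auto simp: rank_def card_mono)
  qed
  then have "rank A f ` A = {1..card A}"
    using card_image[OF inj] by (intro card_subset_eq) auto
  with inj show ?thesis by (simp add: bij_betw_def)
qed

text \<open>Uniqueness of standardisation: \<open>f\<close> and \<open>g\<close> order
  \<open>A\<close> in the same way, and the rank of \<open>x\<close> under \<open>g\<close> is
  \<open>g x\<close> itself because \<open>g\<close> takes each value from 1 to \<open>n\<close>
  once.\<close>

lemma eq_rankI:
  fixes f :: "'a \<Rightarrow> 'b::linorder"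
  assumes bij: "bij_betw g A {1..n}" and "x \<in> A"
    and mono: "\<And>x y. x \<in> A \<Longrightarrow> y \<in> A \<Longrightarrow> g x < g y \<Longrightarrow> f x < f y"
  shows "g x = rank A f x"
proof -
  \<comment> \<open>Monotonicity is given in one direction only; trichotomy of the values of
    \<open>g\<close> and its injectivity supply the other.\<close>
  have "f y \<le> f x \<longleftrightarrow> g y \<le> g x" if "y \<in> A" for y
  proof (cases "g y" "g x" rule: linorder_cases)
    case equal
    then have "y = x" using bij that \<open>x \<in> A\<close> by (auto simp: bij_betw_def inj_on_def)
    then show ?thesis by simp
  next
    case less
    then show ?thesis using mono[OF that \<open>x \<in> A\<close>] by simp
  next
    case greater
    then show ?thesis using mono[OF \<open>x \<in> A\<close> that] by simp
  qed
  then have "rank A f x = card {y \<in> A. g y \<le> g x}"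
    unfolding rank_def by (intro arg_cong[where f = card]) auto
  also have "\<dots> = card (g ` {y \<in> A. g y \<le> g x})"
    using bij by (intro card_image[symmetric]) (auto simp: bij_betw_def inj_on_def)
  also have "g ` {y \<in> A. g y \<le> g x} = {1..g x}"
  proof (intro set_eqI iffI)
    fix k assume "k \<in> {1..g x}"
    moreover have "g x \<in> {1..n}" using bij \<open>x \<in> A\<close> by (auto simp: bij_betw_def)
    ultimately have "k \<in> g ` A" using bij by (simp add: bij_betw_def)
    then show "k \<in> g ` {y \<in> A. g y \<le> g x}" using \<open>k \<in> {1..g x}\<close> by auto
  next
    fix k assume "k \<in> g ` {y \<in> A. g y \<le> g x}"
    then obtain y where "y \<in> A" "g y \<le> g x" "k = g y" by blast
    moreover from this have "g y \<in> {1..n}" using bij by (auto simp: bij_betw_def)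
    ultimately show "k \<in> {1..g x}" by simp
  qed
  finally show ?thesis by simp
qed

text \<open>Pairs are ordered lexicographically, so the row number only breaks ties between equal
  entries, the lower row coming first.\<close>

definition reading_key :: "(nat \<times> nat \<Rightarrow> nat) \<Rightarrow> nat \<times> nat \<Rightarrow> nat \<times> nat" where
  "reading_key U x = (U x, fst x)"

lemma reading_key_less_iff:
  "reading_key U x < reading_key U y \<longleftrightarrow> U x < U y \<or> U x = U y \<and> fst x < fst y"
  by (auto simp: reading_key_def less_prod_def)

text \<open>Cells with equal keys share a row, and strict increase along rows excludes equal entries
  in distinct cells of a row.\<close>

lemma inj_on_reading_key:
  assumes "U \<in> row_strict_tableaux \<alpha>"
  shows "inj_on (reading_key U) (diagram \<alpha>)"
proof (rule inj_onI)
  fix x y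
  assume xy: "x \<in> diagram \<alpha>" "y \<in> diagram \<alpha>" "reading_key U x = reading_key U y"
  obtain r c c' where "x = (r, c)" "y = (r, c')"
    using xy(3) by (cases x; cases y) (auto simp: reading_key_def)
  then show "x = y"
    using assms xy by (cases c c' rule: linorder_cases)
      (fastforce simp: row_strict_tableaux_def reading_key_def)+
qed

section \<open>Substituting words into standard tableaux, and its inverse, standardisation\<close>

definition substitute_word :: "nat list \<Rightarrow> (nat \<times> nat \<Rightarrow> nat) \<Rightarrow> nat list \<Rightarrow> nat \<times> nat \<Rightarrow> nat" where
  "substitute_word \<alpha> S w = (\<lambda>x\<in>diagram \<alpha>. w ! (S x - 1))"

context
  fixes \<alpha> :: "nat list" and S :: "nat \<times> nat \<Rightarrow> nat" and w :: "nat list"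
  assumes S: "S \<in> standard_row_strict_tableaux \<alpha>"
    and w: "w \<in> fundamental_words (comp_of_set (sum_list \<alpha>) (descents \<alpha> S))"
begin

lemma bij_S: "bij_betw S (diagram \<alpha>) {1..sum_list \<alpha>}"
  using S by (simp add: standard_row_strict_tableaux_def)

lemma S_range: "x \<in> diagram \<alpha> \<Longrightarrow> 1 \<le> S x \<and> S x \<le> sum_list \<alpha>"
  using bij_S by (auto simp: bij_betw_def)

lemma w_word:
  "length w = sum_list \<alpha>" "set w \<subseteq> {1..}" "sorted w" "j \<in> descents \<alpha> S \<Longrightarrow> w ! (j - 1) \<noteq> w ! j"
  using w by (auto simp: fundamental_words_comp_of_set[OF descents_subset])

lemma substitute_word_mono:
  assumes "x \<in> diagram \<alpha>" "y \<in> diagram \<alpha>" "S x \<le> S y"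
  shows "substitute_word \<alpha> S w x \<le> substitute_word \<alpha> S w y"
proof -
  have "S y - 1 < length w"
    using S_range[OF assms(2)] unfolding w_word(1) by arith
  then show ?thesis
    using assms S_range by (auto simp: substitute_word_def intro!: sorted_nth_mono w_word(3))
qed

text \<open>Consecutive entries of \<open>S\<close> suffice, since induction on
  \<open>S y - S x\<close> chains them. Their letters weakly increase; if the letters agree, there
  is no descent, so the larger entry of \<open>S\<close> lies strictly higher and the row number
  decides.\<close>

lemma reading_key_substitute_word_less:
  assumes "x \<in> diagram \<alpha>" "y \<in> diagram \<alpha>" "S x < S y"
  shows "reading_key (substitute_word \<alpha> S w) x < reading_key (substitute_word \<alpha> S w) y"
  using assms
proof (induction "S y - S x" arbitrary: y)
  case 0
  then show ?case by simp
next
  case (Suc d)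
  let ?U = "substitute_word \<alpha> S w"
  \<comment> \<open>The value \<open>S y - 1\<close> is still an entry of \<open>S\<close> because
    it is at least \<open>S x\<close>.\<close>
  have "S y - 1 \<in> {1..sum_list \<alpha>}"
    using Suc.prems S_range[of x] S_range[of y] by auto
  then obtain z where z: "z \<in> diagram \<alpha>" "S z = S y - 1"
    using bij_S by (metis bij_betw_imp_surj_on imageE)
  have z_y: "reading_key ?U z < reading_key ?U y"
  proof (cases "?U z = ?U y")
    case True
    \<comment> \<open>The letter placed in \<open>y\<close> has index \<open>S y - 1 = S z\<close>,
      so these are the two positions compared at a possible descent \<open>S z\<close>.\<close>
    then have "w ! (S z - 1) = w ! S z"
      using z Suc.prems by (simp add: substitute_word_def)
    then have "S z \<notin> descents \<alpha> S"
      using w_word(4) by blast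
    then have "\<not> fst y \<le> fst z"
      using z Suc.prems S_range[of z] S_range[of y]
      unfolding descents_def by (cases y; cases z) fastforce
    then show ?thesis using True by (simp add: reading_key_less_iff)
  next
    case False
    moreover have "?U z \<le> ?U y"
      using z Suc.prems by (intro substitute_word_mono) auto
    ultimately show ?thesis by (simp add: reading_key_less_iff)
  qed
  show ?case
  proof (cases "S x = S z")
    case True
    then have "x = z" using bij_S z Suc.prems by (auto simp: bij_betw_def inj_on_def)
    then show ?thesis using z_y by simp
  next
    case False
    then have "reading_key ?U x < reading_key ?U z"
      using Suc z by (intro Suc.hyps(1)) auto
    then show ?thesis using z_y by (rule less_trans)
  qed
qed

lemma substitute_word_in_row_strict_tableaux:
  "substitute_word \<alpha> S w \<in> row_strict_tableaux \<alpha>"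
proof -
  let ?U = "substitute_word \<alpha> S w"
  have std: "S \<in> row_strict_tableaux \<alpha>"
    using S by (simp add: standard_row_strict_tableaux_def)
  have "?U \<in> diagram \<alpha> \<rightarrow>\<^sub>E {1..}"
  proof
    fix x assume "x \<in> diagram \<alpha>"
    moreover from this have "w ! (S x - 1) \<in> set w"
      using S_range[of x] by (intro nth_mem) (simp add: w_word(1), arith)
    ultimately show "?U x \<in> {1..}"
      using w_word(2) by (auto simp: substitute_word_def)
  qed (simp add: substitute_word_def)
  moreover have "?U (r, 0) \<le> ?U (r', 0)"
    if "r < r'" "(r, 0) \<in> diagram \<alpha>" "(r', 0) \<in> diagram \<alpha>" for r r'
    using std that by (intro substitute_word_mono) (auto simp: row_strict_tableaux_def)
  moreover have "?U (r, c) < ?U (r, c')"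
    if "c < c'" "(r, c) \<in> diagram \<alpha>" "(r, c') \<in> diagram \<alpha>" for r c c'
  proof -
    \<comment> \<open>Both cells have the same row number, so a strict increase of the key is a
      strict increase of the entry.\<close>
    have "S (r, c) < S (r, c')" using std that by (auto simp: row_strict_tableaux_def)
    from reading_key_substitute_word_less[OF that(2,3) this]
    show ?thesis by (simp add: reading_key_less_iff)
  qed
  ultimately show ?thesis by (simp add: row_strict_tableaux_def)
qed

lemma content_substitute_word: "content \<alpha> (substitute_word \<alpha> S w) = mset w"
proof -
  have "content \<alpha> (substitute_word \<alpha> S w) = image_mset (\<lambda>x. w ! (S x - 1)) (mset_set (diagram \<alpha>))"
    unfolding content_def by (intro image_mset_cong) (auto simp: substitute_word_def finite_diagram)
  also have "\<dots> = image_mset (\<lambda>i. w ! (i - 1)) (image_mset S (mset_set (diagram \<alpha>)))"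
    by (simp add: multiset.map_comp comp_def)
  \<comment> \<open>The entries of \<open>S\<close> are 1 to \<open>n\<close>, once each; writing
    them as successors of 0 to \<open>n - 1\<close> matches the indexing of lists.\<close>
  also have "image_mset S (mset_set (diagram \<alpha>)) = mset_set (Suc ` {0..<sum_list \<alpha>})"
    using bij_S by (simp add: bij_betw_def image_mset_mset_set
        atLeastLessThanSuc_atLeastAtMost)
  also have "\<dots> = image_mset Suc (mset_set {0..<sum_list \<alpha>})"
    by (simp add: image_mset_mset_set)
  also have "image_mset (\<lambda>i. w ! (i - 1)) \<dots> = mset (map ((!) w) [0..<length w])"
    by (simp add: multiset.map_comp comp_def w_word(1))
  also have "\<dots> = mset w" by (simp only: map_nth)
  finally show ?thesis .
qed

text \<open>This recovers \<open>S\<close> from the substituted tableau and so yields injectivity: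
  the keys increase along \<open>S\<close>, so \<open>S\<close> must be their rank function.
  Restriction makes the two functions agree outside the diagram too.\<close>

lemma restrict_rank_reading_key_substitute_word:
  "restrict (rank (diagram \<alpha>) (reading_key (substitute_word \<alpha> S w))) (diagram \<alpha>) = S"
proof (rule extensionalityI)
  show "S \<in> extensional (diagram \<alpha>)"
    using S by (simp add: standard_row_strict_tableaux_def row_strict_tableaux_def PiE_iff)
  fix x assume x: "x \<in> diagram \<alpha>"
  have "S x = rank (diagram \<alpha>) (reading_key (substitute_word \<alpha> S w)) x"
    using bij_S x reading_key_substitute_word_less by (rule eq_rankI)
  then show "restrict (rank (diagram \<alpha>) (reading_key (substitute_word \<alpha> S w))) (diagram \<alpha>) x = S x"
    using x by simp
qed (rule restrict_extensional)

end

text \<open>The preimage is built by standardisation: \<open>S\<close> ranks the cells by reading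
  key, \<open>T\<close> finds the cell with a given rank, and \<open>w\<close> lists the entries of
  \<open>U\<close> by rank.\<close>

lemma substitute_word_surj:
  assumes U: "U \<in> row_strict_tableaux \<alpha>"
  obtains S w where "S \<in> standard_row_strict_tableaux \<alpha>"
    "w \<in> fundamental_words (comp_of_set (sum_list \<alpha>) (descents \<alpha> S))"
    "substitute_word \<alpha> S w = U"
proof
  let ?D = "diagram \<alpha>" and ?n = "sum_list \<alpha>"
  define S where "S = restrict (rank ?D (reading_key U)) ?D"
  define T where "T = the_inv_into ?D S"
  define w where "w = map (\<lambda>i. U (T (Suc i))) [0..<?n]"
  have bij: "bij_betw S ?D {1..?n}"
    unfolding S_def
    using bij_betw_rank[OF finite_diagram inj_on_reading_key[OF U]]
    by (simp add: bij_betw_def card_diagram inj_on_def)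
  have S_less_iff: "S x < S y \<longleftrightarrow> reading_key U x < reading_key U y" if "x \<in> ?D" "y \<in> ?D" for x y
    using that rank_less_iff[OF finite_diagram] by (simp add: S_def)
  have T_S: "T (S x) = x" if "x \<in> ?D" for x
    using bij that by (simp add: T_def bij_betw_def the_inv_into_f_f)
  have T: "T i \<in> ?D" "S (T i) = i" if "i \<in> {1..?n}" for i
    using bij that
    by (auto simp: T_def bij_betw_def intro: the_inv_into_into f_the_inv_into_f)
  have U_mono: "U x \<le> U y" if "x \<in> ?D" "y \<in> ?D" "S x \<le> S y" for x y
  proof (rule ccontr)
    assume "\<not> U x \<le> U y"
    then have "S y < S x" using that by (simp add: S_less_iff reading_key_less_iff)
    then show False using that by simp
  qed
  have w_nth: "w ! (S x - 1) = U x" if "x \<in> ?D" for x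
  proof -
    have "S x \<in> {1..?n}" using bij that by (auto simp: bij_betw_def)
    then have "S x - 1 < ?n" "Suc (S x - 1) = S x" by auto
    then show ?thesis using T_S[OF that] by (simp add: w_def)
  qed
  have pos: "U x \<ge> 1" if "x \<in> ?D" for x
    using U that by (auto simp: row_strict_tableaux_def)
  show "S \<in> standard_row_strict_tableaux \<alpha>"
  proof -
    have "S \<in> ?D \<rightarrow>\<^sub>E {1..}"
    proof
      fix x assume "x \<in> ?D"
      then have "S x \<in> {1..?n}" using bij by (auto simp: bij_betw_def)
      then show "S x \<in> {1..}" by simp
    qed (simp add: S_def)
    moreover have "S (r, 0) \<le> S (r', 0)"
      if "r < r'" "(r, 0) \<in> ?D" "(r', 0) \<in> ?D" for r r'
    proof -
      \<comment> \<open>Even if these entries are equal, the lower cell has the smaller key, so the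
        first column of \<open>S\<close> increases strictly.\<close>
      have "U (r, 0) \<le> U (r', 0)" using U that by (auto simp: row_strict_tableaux_def)
      then have "S (r, 0) < S (r', 0)"
        using that by (auto simp: S_less_iff reading_key_less_iff)
      then show ?thesis by simp
    qed
    moreover have "S (r, c) < S (r, c')"
      if "c < c'" "(r, c) \<in> ?D" "(r, c') \<in> ?D" for r c c'
      using U that by (auto simp: S_less_iff reading_key_less_iff row_strict_tableaux_def)
    ultimately show ?thesis
      using bij by (simp add: standard_row_strict_tableaux_def row_strict_tableaux_def)
  qed
  show "w \<in> fundamental_words (comp_of_set ?n (descents \<alpha> S))"
    unfolding fundamental_words_comp_of_set[OF descents_subset]
  proof (intro conjI ballI)
    show "length w = ?n" by (simp add: w_def)
    show "set w \<subseteq> {1..}" by (auto simp: w_def intro!: pos T(1) simp flip: One_nat_def)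
    show "sorted w" unfolding sorted_iff_nth_mono
      using T by (auto simp: w_def intro!: U_mono)
    fix j assume "j \<in> descents \<alpha> S"
    then obtain x y where xy: "x \<in> ?D" "S x = j" "y \<in> ?D" "S y = j + 1" "fst y \<le> fst x"
      unfolding descents_def by fastforce
    \<comment> \<open>The cell of \<open>j + 1\<close> is weakly below that of \<open>j\<close>, so
      the larger key cannot come from the row number and the entry itself must grow.\<close>
    have "reading_key U x < reading_key U y"
      using S_less_iff[OF xy(1,3)] xy by simp
    then have "U x \<noteq> U y" using xy by (auto simp: reading_key_less_iff)
    then show "w ! (j - 1) \<noteq> w ! j"
      using w_nth[OF xy(1)] w_nth[OF xy(3)] xy by simp
  qed
  show "substitute_word \<alpha> S w = U"
  proof
    fix x
    \<comment> \<open>Outside the diagram both sides are \<open>undefined\<close>.\<close>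
    show "substitute_word \<alpha> S w x = U x"
      using w_nth[of x] U by (cases "x \<in> ?D")
        (auto simp: substitute_word_def row_strict_tableaux_def dest: PiE_arb)
  qed
qed

text \<open>Fixing the monomial \<open>m\<close> restricts the correspondence to finite sets that
  can be counted. Substitution preserves the monomial, so it maps the fibre over \<open>m\<close>
  onto the fibre over \<open>m\<close>.\<close>

lemma bij_betw_substitute_word:
  "bij_betw (\<lambda>(S, w). substitute_word \<alpha> S w)
    (SIGMA S:standard_row_strict_tableaux \<alpha>.
      {w \<in> fundamental_words (comp_of_set (sum_list \<alpha>) (descents \<alpha> S)). mset w = m})
    {U \<in> row_strict_tableaux \<alpha>. content \<alpha> U = m}"
  (is "bij_betw ?f ?A ?B")
proof -
  have "inj_on ?f ?A"
  proof (rule inj_onI, clarify)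
    fix S w S' w'
    assume S: "S \<in> standard_row_strict_tableaux \<alpha>"
      and w: "w \<in> fundamental_words (comp_of_set (sum_list \<alpha>) (descents \<alpha> S))"
      and S': "S' \<in> standard_row_strict_tableaux \<alpha>"
      and w': "w' \<in> fundamental_words (comp_of_set (sum_list \<alpha>) (descents \<alpha> S'))"
      and eq: "substitute_word \<alpha> S w = substitute_word \<alpha> S' w'" and m: "mset w' = mset w"
    have "S = S'"
      using restrict_rank_reading_key_substitute_word[OF S w]
        restrict_rank_reading_key_substitute_word[OF S' w']
      unfolding eq by (rule trans[OF sym])
    \<comment> \<open>A sorted list is determined by its multiset of entries.\<close>
    moreover have "w = w'"
      using m w_word(3)[OF S w] w_word(3)[OF S' w'] by (metis properties_for_sort)
    ultimately show "S = S' \<and> w = w'" ..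
  qed
  moreover have "?f ` ?A = ?B"
  proof (intro set_eqI iffI)
    fix U assume "U \<in> ?f ` ?A"
    then show "U \<in> ?B"
      using substitute_word_in_row_strict_tableaux content_substitute_word by auto
  next
    fix U assume U: "U \<in> ?B"
    then obtain S w where Sw: "S \<in> standard_row_strict_tableaux \<alpha>"
      "w \<in> fundamental_words (comp_of_set (sum_list \<alpha>) (descents \<alpha> S))"
      "substitute_word \<alpha> S w = U"
      using substitute_word_surj by blast
    then have "(S, w) \<in> ?A" using content_substitute_word[OF Sw(1,2)] U by simp
    then show "U \<in> ?f ` ?A" using Sw(3) by force
  qed
  ultimately show ?thesis by (simp add: bij_betw_def)
qed

section \<open>Comparison of coefficients\<close>

theorem theorem3p5:
  fixes \<alpha> :: "nat list" and n :: nat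
  assumes "composition \<alpha> n"
  shows "row_strict_dual_immaculate \<alpha> =
    (\<Sum>S \<in> standard_row_strict_tableaux \<alpha>. fundamental (comp_of_set n (descents \<alpha> S)))"
proof
  fix m
  have n: "n = sum_list \<alpha>" using assms by (simp add: composition_def)
  \<comment> \<open>Sums of power series are taken coefficientwise; for infinite \<open>A\<close>
    both sides are 0.\<close>
  have sum_apply: "(\<Sum>S\<in>A. g S) m = (\<Sum>S\<in>A. g S m)"
    for g :: "(nat \<times> nat \<Rightarrow> nat) \<Rightarrow> power_series" and A
    by (induction A rule: infinite_finite_induct) auto
  let ?words = "\<lambda>S. {w \<in> fundamental_words (comp_of_set n (descents \<alpha> S)). mset w = m}"
  have "row_strict_dual_immaculate \<alpha> m =
      int (card (SIGMA S:standard_row_strict_tableaux \<alpha>. ?words S))"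
    unfolding row_strict_dual_immaculate_def monomial_sum_def n
    by (simp only: bij_betw_same_card[OF bij_betw_substitute_word])
  \<comment> \<open>The pairs are counted by their first component, which is legitimate since there
    are finitely many standard tableaux and each set of words is finite.\<close>
  also have "\<dots> = (\<Sum>S\<in>standard_row_strict_tableaux \<alpha>. int (card (?words S)))"
    by (simp add: finite_standard_row_strict_tableaux finite_fundamental_fibre)
  also have "\<dots> =
      (\<Sum>S\<in>standard_row_strict_tableaux \<alpha>. fundamental (comp_of_set n (descents \<alpha> S))) m"
    by (simp only: sum_apply fundamental_def monomial_sum_def)
  finally show "row_strict_dual_immaculate \<alpha> m =
      (\<Sum>S\<in>standard_row_strict_tableaux \<alpha>. fundamental (comp_of_set n (descents \<alpha> S))) m" .
qed

end
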